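(* Let $\lambda>0$, $\mu>0$, and let $g\colon\mathbb{R}^n\to\mathbb{R}\cup\{\infty\}$ be closed, proper, and $\mu$-strongly convex, with minimizer $x_\star$. Let $q=\frac{\lambda\mu}{\lambda\mu+1}$, let $x_0\in\mathbb{R}^n$, set $x_{-1}^\circ=x_0=z_0$, and let the sequences $\{x_k\},\{z_k\}$ be generated by Proximal-TMM: $$x_k=\frac{1-\sqrt q}{1+\sqrt q}x_{k-1}^\circ+\left(1-\frac{1-\sqrt q}{1+\sqrt q}\right)z_k,\qquad z_{k+1}=\sqrt q\,x_k^{\circ\circ}+(1-\sqrt q)z_k,\qquad k=0,1,\dots.$$ Then, for all $k=0,1,\dots$, $$\|z_k-x_\star\|^2\le\frac2\mu\left(1-\sqrt q\right)^{2k}\left(g(x_0)-g(x_\star)\right).$$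
   Context: $\|\cdot\|$ is the Euclidean norm. $g$ is $\mu$-strongly convex if $g(x)-(\mu/2)\|x\|^2$ is convex. $x^\circ=\operatorname{Prox}_{\lambda g}(x)=\operatorname*{arg\,min}_{y\in\mathbb{R}^n}\{g(y)+\frac1{2\lambda}\|y-x\|^2\}$, $\tilde\nabla_{1/\lambda}g(x):=-\frac1\lambda(x^\circ-x)$, and $x_k^{\circ\circ}=x_k-\left(\lambda+\frac1\mu\right)\tilde\nabla_{1/\lambda}g(x_k)$. *)

theory Defs
  imports "HOL-Analysis.Analysis"
begin

text \<open>
  Functions into \<open>\<real> \<union> {\<infinity>}\<close> are functions into \<^typ>\<open>ereal\<close> that omit \<open>-\<infinity>\<close>, which is part
  of properness. Closedness and convexity are those of the epigraph, a subset of
  \<open>'a \<times> \<real>\<close>; this avoids undefined sums such as \<open>\<infinity> - \<infinity>\<close> in the convexity inequality.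
\<close>

definition ereal_epigraph :: "('a \<Rightarrow> ereal) \<Rightarrow> ('a \<times> real) set" where
  "ereal_epigraph f = {(x, r). f x \<le> ereal r}"

definition closed_fun :: "('a::topological_space \<Rightarrow> ereal) \<Rightarrow> bool" where
  "closed_fun f \<longleftrightarrow> closed (ereal_epigraph f)"

definition convex_fun :: "('a::real_vector \<Rightarrow> ereal) \<Rightarrow> bool" where
  "convex_fun f \<longleftrightarrow> convex (ereal_epigraph f)"

definition proper_fun :: "('a \<Rightarrow> ereal) \<Rightarrow> bool" where
  "proper_fun f \<longleftrightarrow> (\<forall>x. f x \<noteq> -\<infinity>) \<and> (\<exists>x. f x \<noteq> \<infinity>)"

definition strongly_convex_fun :: "real \<Rightarrow> ('a::real_normed_vector \<Rightarrow> ereal) \<Rightarrow> bool" where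
  "strongly_convex_fun \<mu> g \<longleftrightarrow> convex_fun (\<lambda>x. g x - ereal (\<mu> / 2 * (norm x)\<^sup>2))"

text \<open>
  \<^const>\<open>arg_min\<close> selects some minimizer; for \<open>l > 0\<close> and \<open>g\<close> closed, proper and convex
  on a Euclidean space the minimizer exists and is unique.
\<close>

definition prox :: "real \<Rightarrow> ('a::real_normed_vector \<Rightarrow> ereal) \<Rightarrow> 'a \<Rightarrow> 'a" where
  "prox l g x = (ARG_MIN (\<lambda>y. g y + ereal (1 / (2 * l) * (norm (y - x))\<^sup>2)) y. True)"

text \<open>The map \<open>\<nabla>\<^sub>1\<^sub>/\<^sub>l g\<close>, the gradient of the Moreau envelope of \<open>g\<close>.\<close>

definition prox_grad :: "real \<Rightarrow> ('a::real_normed_vector \<Rightarrow> ereal) \<Rightarrow> 'a \<Rightarrow> 'a" where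
  "prox_grad l g x = - ((1 / l) *\<^sub>R (prox l g x - x))"

text \<open>The map \<open>x \<mapsto> x\<^sup>\<circ>\<^sup>\<circ>\<close>.\<close>

definition circ_circ :: "real \<Rightarrow> real \<Rightarrow> ('a::real_normed_vector \<Rightarrow> ereal) \<Rightarrow> 'a \<Rightarrow> 'a" where
  "circ_circ l \<mu> g x = x - (l + 1 / \<mu>) *\<^sub>R prox_grad l g x"

text \<open>
  Here \<open>xc k\<close> stands for \<open>x\<^sub>k\<^sub>-\<^sub>1\<^sup>\<circ>\<close>, so that \<open>xc 0\<close> is the conventional value of \<open>x\<^sub>-\<^sub>1\<^sup>\<circ>\<close>.
  For \<open>k = 0\<close> the recursion for \<open>x\<close> is consistent with the starting point, since
  \<open>xc 0 = z 0 = x 0\<close>.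
\<close>

definition proximal_tmm ::
  "real \<Rightarrow> real \<Rightarrow> ('a::real_normed_vector \<Rightarrow> ereal) \<Rightarrow> 'a \<Rightarrow>
    (nat \<Rightarrow> 'a) \<Rightarrow> (nat \<Rightarrow> 'a) \<Rightarrow> (nat \<Rightarrow> 'a) \<Rightarrow> bool" where
  "proximal_tmm l \<mu> g x0 x xc z \<longleftrightarrow>
    (let q = l * \<mu> / (l * \<mu> + 1); \<beta> = (1 - sqrt q) / (1 + sqrt q) in
      x 0 = x0 \<and> xc 0 = x0 \<and> z 0 = x0 \<and>
      (\<forall>k. xc (Suc k) = prox l g (x k)) \<and>
      (\<forall>k. x k = \<beta> *\<^sub>R xc k + (1 - \<beta>) *\<^sub>R z k) \<and>
      (\<forall>k. z (Suc k) = sqrt q *\<^sub>R circ_circ l \<mu> g (x k) + (1 - sqrt q) *\<^sub>R z k))"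

end

theory Submission
  imports Defs
begin

text \<open>
  Put \<open>H y = g y - g x\<^sub>\<star> - \<mu>/2 \<parallel>y - x\<^sub>\<star>\<parallel>\<^sup>2\<close>, which is convex and nonnegative and vanishes at
  \<open>x\<^sub>\<star>\<close>, and let \<open>s = (x\<^sub>k - x\<^sub>k\<^sup>\<circ>)/l - \<mu> (x\<^sub>k\<^sup>\<circ> - x\<^sub>\<star>)\<close>, a subgradient of \<open>H\<close> at \<open>x\<^sub>k\<^sup>\<circ>\<close>. Then
  \<open>x\<^sub>k\<^sup>\<circ>\<^sup>\<circ> - x\<^sub>\<star> = - s/\<mu>\<close>, and adding the subgradient inequalities at \<open>x\<^sub>k\<^sub>-\<^sub>1\<^sup>\<circ>\<close> with weight
  \<open>(1 - \<surd>q)\<^sup>2\<close> and at \<open>x\<^sub>\<star>\<close> with weight \<open>1 - (1 - \<surd>q)\<^sup>2\<close> shows that the Lyapunov function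
  \<open>1/2 H(x\<^sub>k\<^sub>-\<^sub>1\<^sup>\<circ>) + \<mu>/2 \<parallel>z\<^sub>k - x\<^sub>\<star>\<parallel>\<^sup>2\<close> contracts by the factor \<open>(1 - \<surd>q)\<^sup>2\<close>. Its initial value is
  \<open>1/2 (g x\<^sub>0 - g x\<^sub>\<star>) + \<mu>/4 \<parallel>x\<^sub>0 - x\<^sub>\<star>\<parallel>\<^sup>2 \<le> g x\<^sub>0 - g x\<^sub>\<star>\<close>.
\<close>

text \<open>Subtracting the quadratic puts both graph points into a convex epigraph; the last term
  is \<open>\<mu> / 2\<close> times the gap in the convexity inequality for the squared
  norm.\<close>

lemma strongly_convex_funD:
  fixes g :: "'a::real_inner \<Rightarrow> ereal"
  assumes "strongly_convex_fun \<mu> g" and a: "g a = ereal A" and b: "g b = ereal B"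
    and t: "0 \<le> t" "t \<le> 1"
  shows "g (a + t *\<^sub>R (b - a))
    \<le> ereal ((1 - t) * A + t * B - \<mu> / 2 * t * (1 - t) * (norm (b - a))\<^sup>2)"
proof -
  let ?h = "\<lambda>x. g x - ereal (\<mu> / 2 * (norm x)\<^sup>2)"
  define A' B' where "A' = A - \<mu> / 2 * (norm a)\<^sup>2" and "B' = B - \<mu> / 2 * (norm b)\<^sup>2"
  have "(a, A') \<in> ereal_epigraph ?h" "(b, B') \<in> ereal_epigraph ?h"
    by (simp_all add: ereal_epigraph_def a b A'_def B'_def)
  then have "(1 - t) *\<^sub>R (a, A') + t *\<^sub>R (b, B') \<in> ereal_epigraph ?h"
    using assms(1) t unfolding strongly_convex_fun_def convex_fun_def
    by (intro convexD) auto
  moreover have m: "(1 - t) *\<^sub>R a + t *\<^sub>R b = a + t *\<^sub>R (b - a)"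
    by (simp add: algebra_simps)
  ultimately have "?h (a + t *\<^sub>R (b - a)) \<le> ereal ((1 - t) * A' + t * B')"
    by (simp add: ereal_epigraph_def)
  then have "g (a + t *\<^sub>R (b - a))
      \<le> ereal ((1 - t) * A' + t * B' + \<mu> / 2 * (norm (a + t *\<^sub>R (b - a)))\<^sup>2)"
    by (cases "g (a + t *\<^sub>R (b - a))") auto
  also have "(1 - t) * A' + t * B' + \<mu> / 2 * (norm (a + t *\<^sub>R (b - a)))\<^sup>2
      = (1 - t) * A + t * B - \<mu> / 2 * t * (1 - t) * (norm (b - a))\<^sup>2"
    by (simp add: A'_def B'_def power2_norm_eq_inner inner_commute algebra_simps
        add_divide_distrib diff_divide_distrib)
  finally show ?thesis .
qed

text \<open>The case \<open>c = 0\<close> is quadratic growth at a minimizer; \<open>c = 1/l\<close> is the subgradient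
  inequality at a proximal point.\<close>

lemma strongly_convex_minimizer_ineq:
  fixes g :: "'a::real_inner \<Rightarrow> ereal"
  assumes sc: "strongly_convex_fun \<mu> g" and y: "g y = ereal Y" and w: "g w = ereal W"
    and min: "\<And>u. g y + ereal (c / 2 * (norm (y - x))\<^sup>2) \<le> g u + ereal (c / 2 * (norm (u - x))\<^sup>2)"
  shows "Y + c * inner (x - y) (w - y) + \<mu> / 2 * (norm (w - y))\<^sup>2 \<le> W"
proof -
  define D where "D = (norm (w - y))\<^sup>2"
  \<comment> \<open>Comparing \<open>y\<close> with \<open>y + t *\<^sub>R (w - y)\<close> and
    dividing by \<open>t\<close> leaves \<open>0 \<le> ?r t\<close>; the claim is the limit as
    \<open>t\<close> falls to 0.\<close>
  let ?r = "\<lambda>t. W - Y - \<mu> / 2 * (1 - t) * D - c * inner (x - y) (w - y) + c / 2 * t * D"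
  have *: "0 \<le> ?r t" if t: "0 < t" "t < 1" for t
  proof -
    let ?m = "y + t *\<^sub>R (w - y)"
    let ?R = "(1 - t) * Y + t * W - \<mu> / 2 * t * (1 - t) * D"
    have "g ?m \<le> ereal ?R"
      unfolding D_def using strongly_convex_funD[OF sc y w] t by simp
    then have "g ?m + ereal (c / 2 * (norm (?m - x))\<^sup>2) \<le> ereal ?R + ereal (c / 2 * (norm (?m - x))\<^sup>2)"
      by (rule add_right_mono)
    from order_trans[OF min[of ?m] this]
    have "Y + c / 2 * (norm (y - x))\<^sup>2 \<le> ?R + c / 2 * (norm (?m - x))\<^sup>2"
      by (simp add: y)
    also have "(norm (?m - x))\<^sup>2
        = (norm (y - x))\<^sup>2 - 2 * t * inner (x - y) (w - y) + t * t * D"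
      by (simp add: D_def power2_norm_eq_inner inner_commute algebra_simps)
    finally have "0 \<le> t * ?r t"
      by (simp add: algebra_simps)
    with t show ?thesis
      by (simp add: zero_le_mult_iff)
  qed
  have "(?r \<longlongrightarrow> ?r 0) (at_right 0)"
    by (intro tendsto_intros)
  moreover have "eventually (\<lambda>t. 0 \<le> ?r t) (at_right 0)"
    using eventually_at_right_real[OF zero_less_one] by eventually_elim (use * in auto)
  ultimately have "0 \<le> ?r 0"
    by (intro tendsto_lowerbound) auto
  then show ?thesis
    by (simp add: D_def)
qed

text \<open>\<open>prox\<close> is a choice, so existence of a minimizer must be shown. As
  \<open>g\<close> may be discontinuous, the search moves to the epigraph, where
  \<open>?\<phi>\<close> is continuous and its sublevel set \<open>S\<close> compact.\<close>

lemma prox_minimizes: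
  fixes g :: "'a::euclidean_space \<Rightarrow> ereal"
  assumes l: "l > 0" and closed: "closed_fun g" and proper: "proper_fun g"
    and bdd: "\<And>y. ereal m \<le> g y"
  shows "g (prox l g x) + ereal (1 / (2 * l) * (norm (prox l g x - x))\<^sup>2)
    \<le> g u + ereal (1 / (2 * l) * (norm (u - x))\<^sup>2)"
proof -
  let ?F = "\<lambda>y. g y + ereal (1 / (2 * l) * (norm (y - x))\<^sup>2)"
  let ?\<phi> = "\<lambda>p. snd p + 1 / (2 * l) * (norm (fst p - x))\<^sup>2"
  obtain y0 r0 where y0: "g y0 = ereal r0"
    using proper unfolding proper_fun_def by (metis ereal_cases)
  define K where "K = ?\<phi> (y0, r0)"
  define S where "S = ereal_epigraph g \<inter> {p. ?\<phi> p \<le> K}"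
  have "(y0, r0) \<in> S"
    by (simp add: S_def K_def ereal_epigraph_def y0)
  have cont: "continuous_on T ?\<phi>" for T
    by (intro continuous_intros)
  have "closed S"
    unfolding S_def using closed cont
    by (intro closed_Int closed_Collect_le continuous_intros) (auto simp: closed_fun_def)
  moreover have "S \<subseteq> cball x (sqrt (2 * l * (K - m))) \<times> {m..K}"
  proof
    fix p assume p: "p \<in> S"
    obtain y r where yr: "p = (y, r)" by force
    from p have gr: "g y \<le> ereal r" and K: "r + 1 / (2 * l) * (norm (y - x))\<^sup>2 \<le> K"
      by (auto simp: S_def ereal_epigraph_def yr)
    have m: "m \<le> r"
      using order_trans[OF bdd gr] by simp
    have "0 \<le> 1 / (2 * l) * (norm (y - x))\<^sup>2"
      using l by simp
    with K have "r \<le> K" by linarith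
    have "1 / (2 * l) * (norm (y - x))\<^sup>2 \<le> K - m"
      using K m by linarith
    then have "(norm (y - x))\<^sup>2 \<le> 2 * l * (K - m)"
      using l by (simp add: field_simps)
    then have "norm (y - x) \<le> sqrt (2 * l * (K - m))"
      by (rule real_le_rsqrt)
    with m \<open>r \<le> K\<close> show "p \<in> cball x (sqrt (2 * l * (K - m))) \<times> {m..K}"
      by (simp add: yr dist_norm norm_minus_commute)
  qed
  then have "bounded S"
    by (rule bounded_subset[rotated]) (intro bounded_Times bounded_cball bounded_closed_interval)
  ultimately have "compact S"
    by (simp add: compact_eq_bounded_closed)
  moreover have "S \<noteq> {}"
    using \<open>(y0, r0) \<in> S\<close> by auto
  ultimately have "\<exists>p\<in>S. \<forall>p'\<in>S. ?\<phi> p \<le> ?\<phi> p'"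
    by (intro continuous_attains_inf cont)
  then obtain p where p: "p \<in> S" and pmin: "\<And>p'. p' \<in> S \<Longrightarrow> ?\<phi> p \<le> ?\<phi> p'"
    by blast
  have "?F (fst p) \<le> ?F v" for v
  proof (cases "g v")
    case (real R)
    \<comment> \<open>Outside \<open>S\<close> the finite points have \<open>?\<phi>\<close> above
      \<open>K\<close>, so the minimum over \<open>S\<close> is global.\<close>
    have \<phi>: "?\<phi> p \<le> ?\<phi> (v, R)"
    proof (cases "(v, R) \<in> S")
      case True
      then show ?thesis by (rule pmin)
    next
      case False
      then have "K < ?\<phi> (v, R)"
        by (auto simp: S_def ereal_epigraph_def real)
      with p show ?thesis by (auto simp: S_def)
    qed
    have "g (fst p) \<le> ereal (snd p)"
      using p by (auto simp: S_def ereal_epigraph_def)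
    then have "?F (fst p) \<le> ereal (snd p) + ereal (1 / (2 * l) * (norm (fst p - x))\<^sup>2)"
      by (rule add_right_mono)
    also have "\<dots> = ereal (?\<phi> p)"
      by simp
    also have "\<dots> \<le> ereal (?\<phi> (v, R))"
      using \<phi> by (simp only: ereal_less_eq)
    also have "\<dots> = ?F v"
      by (simp add: real)
    finally show ?thesis .
  qed (use proper in \<open>auto simp: proper_fun_def\<close>)
  then have "is_arg_min ?F (\<lambda>_. True) (fst p)"
    by (simp add: is_arg_min_def not_less)
  then have "is_arg_min ?F (\<lambda>_. True) (prox l g x)"
    unfolding prox_def arg_min_def by (rule someI)
  then show ?thesis
    by (simp add: is_arg_min_def not_less)
qed

lemma prox_finite:
  fixes g :: "'a::euclidean_space \<Rightarrow> ereal"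
  assumes "l > 0" and "closed_fun g" and proper: "proper_fun g" and "\<And>y. ereal m \<le> g y"
  obtains Y where "g (prox l g x) = ereal Y"
proof -
  obtain u r where "g u = ereal r"
    using proper unfolding proper_fun_def by (metis ereal_cases)
  with prox_minimizes[OF assms, of x u] have "g (prox l g x) \<noteq> \<infinity>"
    by auto
  with proper that show thesis
    unfolding proper_fun_def by (metis ereal_cases)
qed

text \<open>One step of the method, in coordinates centred at the minimizer: \<open>y\<close>, \<open>p\<close> stand for
  \<open>x\<^sub>k\<^sup>\<circ>\<close>, \<open>x\<^sub>k\<^sub>-\<^sub>1\<^sup>\<circ>\<close>, and \<open>hy\<close>, \<open>hp\<close> for the values of \<open>H\<close> there.\<close>

lemma tmm_lyapunov_step:
  fixes x y p z z' s :: "'a::real_inner"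
  assumes l: "l > 0" and \<mu>: "\<mu> > 0" and r: "0 < r" "r < 1" and r2: "r\<^sup>2 = l * \<mu> / (l * \<mu> + 1)"
    and x_y: "x = (1 + l * \<mu>) *\<^sub>R y + l *\<^sub>R s"
    and x_pz: "x = ((1 - r) / (1 + r)) *\<^sub>R p + (1 - (1 - r) / (1 + r)) *\<^sub>R z"
    and z': "z' = - (r / \<mu>) *\<^sub>R s + (1 - r) *\<^sub>R z"
    and sub_p: "hy + inner s (p - y) \<le> hp"
    and sub_0: "hy - inner s y \<le> 0"
  shows "hy / 2 + \<mu> / 2 * (norm z')\<^sup>2 \<le> (1 - r)\<^sup>2 * (hp / 2 + \<mu> / 2 * (norm z)\<^sup>2)"
proof -
  have pos: "l * \<mu> + 1 > 0"
    using l \<mu> by (simp add: add_pos_pos)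
  then have r2': "1 - r\<^sup>2 = 1 / (l * \<mu> + 1)"
    unfolding r2 by (simp add: field_simps)
  \<comment> \<open>By the value of \<open>r\<^sup>2\<close>, the factor
    \<open>1 - r\<^sup>2\<close> turns \<open>x\<close> into
    \<open>y + (r\<^sup>2 / \<mu>) *\<^sub>R s\<close>.\<close>
  have c1: "(1 - r\<^sup>2) * (1 + l * \<mu>) = 1"
    unfolding r2' using pos by (simp add: add.commute)
  have c2: "(1 - r\<^sup>2) * l = r\<^sup>2 / \<mu>"
    unfolding r2' unfolding r2 using \<mu> by simp
  have "1 - (1 - r) / (1 + r) = 2 * r / (1 + r)"
    using r by (simp add: field_simps)
  then have "(1 + r) * inner s x = (1 - r) * inner s p + 2 * r * inner s z"
    using r by (simp add: x_pz inner_add_right distrib_left)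
  \<comment> \<open>The extra factor \<open>1 - r\<close> gives \<open>p\<close> the weight
    \<open>(1 - r)\<^sup>2\<close> of the contraction and \<open>z\<close> the cross term of
    \<open>\<mu> * (norm z')\<^sup>2\<close>.\<close>
  then have "(1 - r) * ((1 + r) * inner s x) = (1 - r) * ((1 - r) * inner s p + 2 * r * inner s z)"
    by simp
  then have "(1 - r\<^sup>2) * inner s x = (1 - r)\<^sup>2 * inner s p + 2 * r * (1 - r) * inner s z"
    by (simp add: power2_eq_square algebra_simps)
  moreover have "(1 - r\<^sup>2) * inner s x
      = (1 - r\<^sup>2) * (1 + l * \<mu>) * inner s y + (1 - r\<^sup>2) * l * inner s s"
    by (simp add: x_y inner_simps algebra_simps)
  ultimately have sz: "2 * r * (1 - r) * inner s z
      = inner s y + r\<^sup>2 / \<mu> * inner s s - (1 - r)\<^sup>2 * inner s p"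
    unfolding c1 c2 by simp
  have "(norm z')\<^sup>2
      = (r / \<mu>)\<^sup>2 * inner s s - 2 * (r / \<mu>) * (1 - r) * inner s z + (1 - r)\<^sup>2 * (norm z)\<^sup>2"
    unfolding z' power2_norm_eq_inner
    by (simp add: inner_simps inner_commute power2_eq_square)
  then have "\<mu> * (norm z')\<^sup>2
      = r\<^sup>2 / \<mu> * inner s s - 2 * r * (1 - r) * inner s z + \<mu> * (1 - r)\<^sup>2 * (norm z)\<^sup>2"
    using \<mu> by (simp add: field_simps power2_eq_square)
  \<comment> \<open>The \<open>inner s s\<close> terms cancel exactly; the remaining products with
    \<open>s\<close> cancel against the weighted subgradient inequalities.\<close>
  then have nz: "\<mu> * (norm z')\<^sup>2
      = (1 - r)\<^sup>2 * inner s p - inner s y + \<mu> * (1 - r)\<^sup>2 * (norm z)\<^sup>2"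
    unfolding sz by simp
  have "(1 - r)\<^sup>2 * (hy + inner s (p - y)) \<le> (1 - r)\<^sup>2 * hp"
    using sub_p by (intro mult_left_mono) auto
  moreover have "(1 - (1 - r)\<^sup>2) * (hy - inner s y) \<le> 0"
    using sub_0 r by (intro mult_nonneg_nonpos) (auto simp: power_le_one)
  ultimately have "hy \<le> inner s y + (1 - r)\<^sup>2 * hp - (1 - r)\<^sup>2 * inner s p"
    by (simp add: inner_diff_right algebra_simps)
  with nz show ?thesis
    by (simp add: algebra_simps)
qed

theorem theorem3:
  fixes g :: "real ^ 'n \<Rightarrow> ereal"
    and l \<mu> q :: real
    and x0 x_star :: "real ^ 'n"
    and x xc z :: "nat \<Rightarrow> real ^ 'n"
  assumes "l > 0" and "\<mu> > 0"
    and "closed_fun g" and "proper_fun g" and "strongly_convex_fun \<mu> g"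
    and "\<And>y. g x_star \<le> g y"
    and "q = l * \<mu> / (l * \<mu> + 1)"
    and "proximal_tmm l \<mu> g x0 x xc z"
  shows "\<And>k. ereal ((norm (z k - x_star))\<^sup>2)
           \<le> ereal (2 / \<mu> * (1 - sqrt q) ^ (2 * k)) * (g x0 - g x_star)"
proof -
  fix k
  note l = assms(1) and \<mu> = assms(2) and min = assms(6) and q = assms(7)
  define r where "r = sqrt q"
  have pos: "l * \<mu> > 0"
    using l \<mu> by simp
  then have q01: "0 < q" "q < 1"
    by (simp_all add: q field_simps)
  then have r: "0 < r" "r < 1"
    by (simp_all add: r_def)
  have r2: "r\<^sup>2 = l * \<mu> / (l * \<mu> + 1)"
    using q01 q by (simp add: r_def)
  have x0: "xc 0 = x0" "z 0 = x0" and xc: "\<And>k. xc (Suc k) = prox l g (x k)"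
    and x: "\<And>k. x k = ((1 - r) / (1 + r)) *\<^sub>R xc k + (1 - (1 - r) / (1 + r)) *\<^sub>R z k"
    and z: "\<And>k. z (Suc k) = r *\<^sub>R circ_circ l \<mu> g (x k) + (1 - r) *\<^sub>R z k"
    using assms(8) unfolding proximal_tmm_def Let_def r_def q by auto
  obtain m where m: "g x_star = ereal m"
  proof -
    obtain u where "g u \<noteq> \<infinity>"
      using assms(4) by (auto simp: proper_fun_def)
    with min[of u] have "g x_star \<noteq> \<infinity>" by auto
    with assms(4) that show thesis
      unfolding proper_fun_def by (metis ereal_cases)
  qed
  have bdd: "\<And>y. ereal m \<le> g y"
    using min m by simp
  \<comment> \<open>This is \<open>H \<ge> 0\<close>: it bounds the initial Lyapunov value and lets
    the \<open>H\<close> term be dropped at the end.\<close>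
  have growth: "m + \<mu> / 2 * (norm (w - x_star))\<^sup>2 \<le> W" if "g w = ereal W" for w W
    using strongly_convex_minimizer_ineq[OF assms(5) m that, of 0] min by simp
  show "ereal ((norm (z k - x_star))\<^sup>2)
           \<le> ereal (2 / \<mu> * (1 - sqrt q) ^ (2 * k)) * (g x0 - g x_star)"
  proof (cases "g x0")
    case (real R)
    \<comment> \<open>The invariant carries finiteness of \<open>g\<close> at \<open>xc k\<close>,
      which starts at \<open>x0\<close>; later values are finite as proximal points.\<close>
    have "\<exists>V. g (xc k) = ereal V
        \<and> (V - m - \<mu> / 2 * (norm (xc k - x_star))\<^sup>2) / 2 + \<mu> / 2 * (norm (z k - x_star))\<^sup>2
          \<le> (1 - r) ^ (2 * k) * (R - m)" for k
    proof (induction k)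
      case 0
      show ?case
        using growth[OF real] by (simp add: x0 real field_simps)
    next
      case (Suc k)
      then obtain V where V: "g (xc k) = ereal V"
        and IH: "(V - m - \<mu> / 2 * (norm (xc k - x_star))\<^sup>2) / 2 + \<mu> / 2 * (norm (z k - x_star))\<^sup>2
          \<le> (1 - r) ^ (2 * k) * (R - m)"
        by blast
      define y where "y = xc (Suc k)"
      have y: "y = prox l g (x k)"
        by (simp add: y_def xc)
      obtain Y where Y: "g y = ereal Y"
        unfolding y using prox_finite[OF assms(1,3,4) bdd] .
      have "g y + ereal (1 / l / 2 * (norm (y - x k))\<^sup>2)
          \<le> g u + ereal (1 / l / 2 * (norm (u - x k))\<^sup>2)" for u
        using prox_minimizes[OF assms(1,3,4) bdd, of "x k" u] by (simp add: y mult.commute)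
      note sub = strongly_convex_minimizer_ineq[OF assms(5) Y _ this]
      \<comment> \<open>A subgradient of \<open>g\<close> at the proximal point \<open>y\<close>,
        minus the gradient there of the quadratic subtracted in \<open>H\<close>.\<close>
      define s where "s = (1 / l) *\<^sub>R (x k - y) - \<mu> *\<^sub>R (y - x_star)"
      have ls: "l *\<^sub>R s = x k - y - (l * \<mu>) *\<^sub>R (y - x_star)"
        using l by (simp add: s_def scaleR_diff_right)
      have cc: "circ_circ l \<mu> g (x k) - x_star = - (1 / \<mu>) *\<^sub>R s"
      proof -
        have "circ_circ l \<mu> g (x k) = x k - ((l + 1 / \<mu>) * (1 / l)) *\<^sub>R (x k - y)"
          unfolding circ_circ_def prox_grad_def y[symmetric] by (simp add: algebra_simps)
        also have "(l + 1 / \<mu>) * (1 / l) = 1 + 1 / \<mu> * (1 / l)"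
          using l by (simp add: field_simps)
        finally show ?thesis
          using \<mu> by (simp add: s_def algebra_simps)
      qed
      have "(Y - m - \<mu> / 2 * (norm (y - x_star))\<^sup>2) / 2 + \<mu> / 2 * (norm (z (Suc k) - x_star))\<^sup>2
        \<le> (1 - r)\<^sup>2 * ((V - m - \<mu> / 2 * (norm (xc k - x_star))\<^sup>2) / 2
            + \<mu> / 2 * (norm (z k - x_star))\<^sup>2)"
      proof (rule tmm_lyapunov_step[OF l \<mu> r r2, where x = "x k - x_star" and s = s])
        show "x k - x_star = (1 + l * \<mu>) *\<^sub>R (y - x_star) + l *\<^sub>R s"
          unfolding ls by (simp add: algebra_simps)
        show "x k - x_star = ((1 - r) / (1 + r)) *\<^sub>R (xc k - x_star)
            + (1 - (1 - r) / (1 + r)) *\<^sub>R (z k - x_star)"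
          by (subst x) (simp add: scaleR_diff_left scaleR_diff_right)
        have "z (Suc k) - x_star
            = r *\<^sub>R (circ_circ l \<mu> g (x k) - x_star) + (1 - r) *\<^sub>R (z k - x_star)"
          by (simp add: z algebra_simps)
        then show "z (Suc k) - x_star = - (r / \<mu>) *\<^sub>R s + (1 - r) *\<^sub>R (z k - x_star)"
          by (simp add: cc)
        show "Y - m - \<mu> / 2 * (norm (y - x_star))\<^sup>2 + inner s (xc k - x_star - (y - x_star))
            \<le> V - m - \<mu> / 2 * (norm (xc k - x_star))\<^sup>2"
        proof -
          \<comment> \<open>Expanding the quadratic about \<open>y\<close> absorbs the curvature
            term, leaving the plain subgradient inequality for \<open>H\<close>.\<close>
          have "(norm (xc k - x_star))\<^sup>2 = (norm (y - x_star))\<^sup>2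
              + 2 * inner (y - x_star) (xc k - y) + (norm (xc k - y))\<^sup>2"
            by (simp add: power2_norm_eq_inner inner_commute algebra_simps)
          then have "\<mu> / 2 * (norm (xc k - x_star))\<^sup>2 = \<mu> / 2 * (norm (y - x_star))\<^sup>2
              + \<mu> * inner (y - x_star) (xc k - y) + \<mu> / 2 * (norm (xc k - y))\<^sup>2"
            by (simp only: distrib_left)
          moreover have "inner s (xc k - x_star - (y - x_star))
              = 1 / l * inner (x k - y) (xc k - y) - \<mu> * inner (y - x_star) (xc k - y)"
            by (simp add: s_def inner_diff_left[of "_ *\<^sub>R _"])
          ultimately show ?thesis
            using sub[OF V] by linarith
        qed
        show "Y - m - \<mu> / 2 * (norm (y - x_star))\<^sup>2 - inner s (y - x_star) \<le> 0"
        proof -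
          have "inner s (y - x_star)
              = - (1 / l * inner (x k - y) (x_star - y)) - \<mu> * (norm (y - x_star))\<^sup>2"
            by (simp add: s_def inner_diff_left[of "_ *\<^sub>R _"] power2_norm_eq_inner)
              (simp add: inner_diff_right diff_divide_distrib)
          then show ?thesis
            using sub[OF m] by (simp add: norm_minus_commute)
        qed
      qed
      also have "\<dots> \<le> (1 - r)\<^sup>2 * ((1 - r) ^ (2 * k) * (R - m))"
        using IH by (intro mult_left_mono) auto
      also have "\<dots> = (1 - r) ^ (2 * Suc k) * (R - m)"
        by (simp add: power2_eq_square)
      finally show ?case
        using Y by (auto simp: y_def)
    qed
    then obtain V where V: "g (xc k) = ereal V" and
      "(V - m - \<mu> / 2 * (norm (xc k - x_star))\<^sup>2) / 2 + \<mu> / 2 * (norm (z k - x_star))\<^sup>2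
          \<le> (1 - r) ^ (2 * k) * (R - m)"
      by blast
    with growth[OF V] have "\<mu> / 2 * (norm (z k - x_star))\<^sup>2 \<le> (1 - r) ^ (2 * k) * (R - m)"
      by argo
    then have "(norm (z k - x_star))\<^sup>2 \<le> 2 / \<mu> * (1 - r) ^ (2 * k) * (R - m)"
      using \<mu> by (simp add: field_simps)
    then show ?thesis
      by (simp add: real m r_def)
  next
    case PInf
    \<comment> \<open>Strict positivity makes the right side infinite; a zero factor would give
      \<open>0 * \<infinity> = 0\<close>.\<close>
    have "2 / \<mu> * (1 - sqrt q) ^ (2 * k) > 0"
      using \<mu> r by (simp add: r_def)
    then show ?thesis
      using \<mu> q01 by (simp add: PInf m)
  next
    case MInf
    with assms(4) show ?thesis by (simp add: proper_fun_def)
  qed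
qed

end
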